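(* Let $K\ge 0$ be an integer. Let $G_1,\ldots,G_n$ be nondeterministic automata, where $G_i$ has set of secret states $Q_i^S$, and consider the composed system $G_1\|\cdots\|G_n$ with interaction $\|_\lor$, i.e. with set of secret states $Q^S=Q\setminus(Q_1^{NS}\times\cdots\times Q_n^{NS})$, $Q_i^{NS}=Q_i\setminus Q_i^S$. For $1\le i\le n$ let $H_i$ be the two-way observer of $G_i$, let $H=H_1\|\cdots\|H_n$ with event set $\Sigma_H$, and let $P_\Delta:\Sigma_H^*\to\Delta_R(\Sigma)^*$ be the natural projection erasing all events not in $\Delta_R(\Sigma)$, where $\Sigma=\Sigma_1\cup\cdots\cup\Sigma_n$. Suppose that for every string $s\in L(H)$ with $H\stackrel{s}{\to}((X^1,X^1_R),\ldots,(X^n,X^n_R))$ the following holds: if there exists $i$ with $X^i\cap X^i_R\subseteq Q_i^S$ and $X^i\cap X^i_R\neq\emptyset$, then $|P_\Delta(s)|>K$. Then $G_1\|\cdots\|G_n$ is $K$-step opaque.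
   Context: An automaton is $G=\langle\Sigma_\tau,Q,\to,Q^\circ\rangle$ with finite set $\Sigma$ of observable events, a special unobservable event $\tau\notin\Sigma$, $\Sigma_\tau=\Sigma\cup\{\tau\}$, finite states $Q$, transitions $\to\subseteq Q\times\Sigma_\tau\times Q$, initial states $Q^\circ$, and secret states $Q^S\subseteq Q$, $Q^{NS}=Q\setminus Q^S$. For $s\in\Sigma^*$, $p\stackrel{s}{\Rightarrow}q$ means there is $t\in\Sigma_\tau^*$ which becomes $s$ after deleting all $\tau$'s and $p\stackrel{t}{\to}q$; $p\stackrel{s}{\Rightarrow}$ means this for some $q$; $L(G,q)=\{s:q\stackrel{s}{\Rightarrow}\}$, $L(G)$ the strings executable from an initial state. Synchronous composition: states are tuples, initial states products of initial states; a shared event (other than $\tau$, never shared) is executed jointly by all components having it in their alphabet; other events are executed by a single component while the others stay put. $K$-step opacity: $G$ is $K$-step opaque w.r.t. $Q^S$ iff for every $q^\circ\in Q^\circ$ and all $s,t\in\Sigma^*$ with $st\in L(G,q^\circ)$, $q^\circ\stackrel{s}{\Rightarrow}Q^S$ and $|t|\le K$, there exist $q'^\circ\in Q^\circ$ and $y\in Q^{NS}$ with $q'^\circ\stackrel{s}{\Rightarrow}y$ and $y\stackrel{t}{\Rightarrow}$. Reversed automaton: $G_R=\langle\Sigma_\tau,Q,\to_R,Q\rangle$ with $(x,\sigma,y)\in\to_R$ iff $y\stackrel{\sigma}{\to}x$, all states initial. Current-state estimator: $UR(B)$ is the set of states reachable from $B$ by strings in $\{\tau\}^*$; $det(G)$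 is the deterministic automaton over $\Sigma$ with initial state $UR(Q^\circ)$ and transitions $X\stackrel{\sigma}{\to}Y$ where $Y=\bigcup\{UR(\{y\}): x\stackrel{\sigma}{\to}y, x\in X\}$ is nonempty; only reachable states are kept. Two-way observer: with renamings $\Delta(\sigma)=(\sigma,\epsilon)$, $\Delta_R(\sigma)=(\epsilon,\sigma)$ relabelling transitions, $H_i=\Delta(det(G_i))\|\Delta_R(det(G_{i,R}))$, a deterministic automaton over $\Delta(\Sigma_i)\cup\Delta_R(\Sigma_i)$ with reachable states $(X^i,X^i_R)$, $X^i,X^i_R\subseteq Q_i$; $H_1\|\cdots\|H_n$ synchronizes on common renamed events. *)

theory Defs
  imports Main "HOL-Library.FuncSet"
begin

text \<open>An event in \<open>\<Sigma>\<^sub>\<tau>\<close> is an option: \<open>None\<close> is the unobservable event \<open>\<tau>\<close>, and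
  \<open>Some \<sigma>\<close> is the observable event \<open>\<sigma>\<close>. The field \<open>alph\<close> is \<open>\<Sigma>\<close>, without \<open>\<tau>\<close>.\<close>

record ('e, 'q) automaton =
  alph :: "'e set"
  states :: "'q set"
  trans :: "('q \<times> 'e option \<times> 'q) set"
  init :: "'q set"

definition automaton :: "('e, 'q) automaton \<Rightarrow> bool" where
  "automaton G \<longleftrightarrow>
     finite (alph G) \<and> finite (states G) \<and>
     trans G \<subseteq> states G \<times> insert None (Some ` alph G) \<times> states G \<and>
     init G \<subseteq> states G"

primrec run :: "('e, 'q) automaton \<Rightarrow> 'q \<Rightarrow> 'e option list \<Rightarrow> 'q \<Rightarrow> bool" where
  "run G p [] q \<longleftrightarrow> p = q"
| "run G p (e # t) q \<longleftrightarrow> (\<exists>r. (p, e, r) \<in> trans G \<and> run G r t q)"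

definition erase_tau :: "'e option list \<Rightarrow> 'e list" where
  "erase_tau t = map the (filter (\<lambda>e. e \<noteq> None) t)"

definition weak_run :: "('e, 'q) automaton \<Rightarrow> 'q \<Rightarrow> 'e list \<Rightarrow> 'q \<Rightarrow> bool" where
  "weak_run G p s q \<longleftrightarrow> (\<exists>t. erase_tau t = s \<and> run G p t q)"

definition lang_from :: "('e, 'q) automaton \<Rightarrow> 'q \<Rightarrow> 'e list set" where
  "lang_from G q = {s \<in> lists (alph G). \<exists>r. weak_run G q s r}"

definition lang :: "('e, 'q) automaton \<Rightarrow> 'e list set" where
  "lang G = (\<Union>q \<in> init G. lang_from G q)"

text \<open>\<open>leads_to G s x\<close> is \<open>G \<rightarrow> x\<close> under the string \<open>s\<close> of observable events, without
  interspersed \<open>\<tau>\<close>-transitions.\<close>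

definition leads_to :: "('e, 'q) automaton \<Rightarrow> 'e list \<Rightarrow> 'q \<Rightarrow> bool" where
  "leads_to G s x \<longleftrightarrow> (\<exists>q \<in> init G. run G q (map Some s) x)"

definition k_step_opaque :: "nat \<Rightarrow> ('e, 'q) automaton \<Rightarrow> 'q set \<Rightarrow> bool" where
  "k_step_opaque K G S \<longleftrightarrow>
     (\<forall>q0 \<in> init G. \<forall>s \<in> lists (alph G). \<forall>t \<in> lists (alph G).
        s @ t \<in> lang_from G q0 \<and> (\<exists>x \<in> S. weak_run G q0 s x) \<and> length t \<le> K \<longrightarrow>
        (\<exists>q0' \<in> init G. \<exists>y \<in> states G - S.
           weak_run G q0' s y \<and> (\<exists>z. weak_run G y t z)))"

text \<open>The composition of a family of automata indexed by \<open>I\<close>; a state tuple is an extensional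
  function on \<open>I\<close>.\<close>

definition sync :: "'i set \<Rightarrow> ('i \<Rightarrow> ('e, 'q) automaton) \<Rightarrow> ('e, 'i \<Rightarrow> 'q) automaton" where
  "sync I G =
     \<lparr>alph = (\<Union>i\<in>I. alph (G i)),
      states = (\<Pi>\<^sub>E i\<in>I. states (G i)),
      trans =
        {(p, Some \<sigma>, q) | p \<sigma> q.
           p \<in> (\<Pi>\<^sub>E i\<in>I. states (G i)) \<and> q \<in> (\<Pi>\<^sub>E i\<in>I. states (G i)) \<and>
           \<sigma> \<in> (\<Union>i\<in>I. alph (G i)) \<and>
           (\<forall>i\<in>I. if \<sigma> \<in> alph (G i) then (p i, Some \<sigma>, q i) \<in> trans (G i) else q i = p i)} \<union>
        {(p, None, q) | p q.
           p \<in> (\<Pi>\<^sub>E i\<in>I. states (G i)) \<and> q \<in> (\<Pi>\<^sub>E i\<in>I. states (G i)) \<and>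
           (\<exists>i\<in>I. (p i, None, q i) \<in> trans (G i) \<and> (\<forall>j \<in> I - {i}. q j = p j))},
      init = (\<Pi>\<^sub>E i\<in>I. init (G i))\<rparr>"

text \<open>The same composition for two automata whose state types may differ, with pairs as states.\<close>

definition sync2 :: "('e, 'p) automaton \<Rightarrow> ('e, 'q) automaton \<Rightarrow> ('e, 'p \<times> 'q) automaton" where
  "sync2 A B =
     \<lparr>alph = alph A \<union> alph B,
      states = states A \<times> states B,
      trans =
        {((a, b), Some \<sigma>, (a', b')) | a b \<sigma> a' b'.
           a \<in> states A \<and> a' \<in> states A \<and> b \<in> states B \<and> b' \<in> states B \<and>
           \<sigma> \<in> alph A \<union> alph B \<and>
           (if \<sigma> \<in> alph A then (a, Some \<sigma>, a') \<in> trans A else a' = a) \<and>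
           (if \<sigma> \<in> alph B then (b, Some \<sigma>, b') \<in> trans B else b' = b)} \<union>
        {((a, b), None, (a', b)) | a b a'. b \<in> states B \<and> (a, None, a') \<in> trans A} \<union>
        {((a, b), None, (a, b')) | a b b'. a \<in> states A \<and> (b, None, b') \<in> trans B},
      init = init A \<times> init B\<rparr>"

definition reversed :: "('e, 'q) automaton \<Rightarrow> ('e, 'q) automaton" where
  "reversed G =
     \<lparr>alph = alph G,
      states = states G,
      trans = {(x, e, y). (y, e, x) \<in> trans G},
      init = states G\<rparr>"

definition accessible :: "('e, 'q) automaton \<Rightarrow> ('e, 'q) automaton" where
  "accessible G =
     (let R = {q. \<exists>q0 \<in> init G. \<exists>t. run G q0 t q} in
      \<lparr>alph = alph G,
       states = states G \<inter> R,
       trans = trans G \<inter> (R \<times> UNIV \<times> R),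
       init = init G\<rparr>)"

definition UR :: "('e, 'q) automaton \<Rightarrow> 'q set \<Rightarrow> 'q set" where
  "UR G B = {y. \<exists>x \<in> B. \<exists>t \<in> lists {None}. run G x t y}"

definition det :: "('e, 'q) automaton \<Rightarrow> ('e, 'q set) automaton" where
  "det G = accessible
     \<lparr>alph = alph G,
      states = Pow (states G),
      trans =
        {(X, Some \<sigma>, Y) | X \<sigma> Y.
           X \<subseteq> states G \<and> \<sigma> \<in> alph G \<and>
           Y = \<Union> {UR G {y} | x y. x \<in> X \<and> (x, Some \<sigma>, y) \<in> trans G} \<and> Y \<noteq> {}},
      init = {UR G (init G)}\<rparr>"

text \<open>In the renamed events \<open>(\<sigma>, \<epsilon>)\<close> and \<open>(\<epsilon>, \<sigma>)\<close>, the empty string \<open>\<epsilon>\<close> is \<open>None\<close>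
  (unrelated to the use of \<open>None\<close> for \<open>\<tau>\<close>).\<close>

definition Delta :: "'e \<Rightarrow> 'e option \<times> 'e option" where
  "Delta \<sigma> = (Some \<sigma>, None)"

definition Delta_R :: "'e \<Rightarrow> 'e option \<times> 'e option" where
  "Delta_R \<sigma> = (None, Some \<sigma>)"

definition rename :: "('e \<Rightarrow> 'f) \<Rightarrow> ('e, 'q) automaton \<Rightarrow> ('f, 'q) automaton" where
  "rename f G =
     \<lparr>alph = f ` alph G,
      states = states G,
      trans = {(x, map_option f e, y) | x e y. (x, e, y) \<in> trans G},
      init = init G\<rparr>"

definition two_way_observer ::
    "('e, 'q) automaton \<Rightarrow> ('e option \<times> 'e option, 'q set \<times> 'q set) automaton" where
  "two_way_observer G = sync2 (rename Delta (det G)) (rename Delta_R (det (reversed G)))"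

definition nat_proj :: "'e set \<Rightarrow> 'e list \<Rightarrow> 'e list" where
  "nat_proj A s = filter (\<lambda>e. e \<in> A) s"

end

theory Submission
  imports Defs
begin

text \<open>Split a run of the composed system on \<open>s @ t\<close> after \<open>s\<close>. In each component the intermediate
  state lies in the current-state estimate after \<open>s\<close> and in the estimate of the reversed automaton
  after \<open>rev t\<close>, and \<open>H\<close> reaches the tuple of these pairs of estimates by
  \<open>\<Delta>(s) \<Delta>\<^sub>R(rev t)\<close>. Its projection has length at most \<open>K\<close>, so every intersection
  of the two estimates contains a nonsecret state. Such states can be chosen independently in the
  components: they are all reached by projections of the same \<open>s\<close> and continue with projections of
  the same \<open>t\<close>, so the component runs synchronize.\<close>

section \<open>Runs, erasure of unobservable events, and weak runs\<close>

lemma run_append: "run G p (t @ u) q \<longleftrightarrow> (\<exists>r. run G p t r \<and> run G r u q)"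
  by (induction t arbitrary: p) auto

lemma run_snoc: "run G p (t @ [e]) q \<longleftrightarrow> (\<exists>r. run G p t r \<and> (r, e, q) \<in> trans G)"
  by (simp add: run_append)

lemma erase_tau_simps [simp]:
  "erase_tau [] = []"
  "erase_tau (None # t) = erase_tau t"
  "erase_tau (Some a # t) = a # erase_tau t"
  "erase_tau (t @ u) = erase_tau t @ erase_tau u"
  "erase_tau (rev t) = rev (erase_tau t)"
  "erase_tau (map Some s) = s"
  by (simp_all add: erase_tau_def rev_filter rev_map comp_def)

lemma erase_tau_eq_Nil_iff: "erase_tau t = [] \<longleftrightarrow> t \<in> lists {None}"
  by (auto simp: erase_tau_def filter_empty_conv)

text \<open>This cuts a weak run at any point of its observable string. The cut is made as early as
  possible: once \<open>s\<close> is used up, \<open>u1\<close> ends, so unobservable events at the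
  border fall to \<open>u2\<close>.\<close>

lemma erase_tau_eq_appendD:
  "erase_tau u = s @ t \<Longrightarrow> \<exists>u1 u2. u = u1 @ u2 \<and> erase_tau u1 = s \<and> erase_tau u2 = t"
proof (induction u arbitrary: s)
  case (Cons e u)
  show ?case
  proof (cases "s = []")
    case True
    then show ?thesis
      using Cons.prems by (intro exI[of _ "[]"] exI[of _ "e # u"]) simp
  next
    case False
    \<comment> \<open>One equation for both kinds of \<open>e\<close>: \<open>s'\<close> is
      \<open>s\<close> itself if \<open>e\<close> is \<open>None\<close>, and the tail of
      \<open>s\<close> otherwise.\<close>
    obtain s' where s': "erase_tau u = s' @ t" "erase_tau [e] @ s' = s"
      using Cons.prems False by (cases e; cases s) auto
    obtain u1 u2 where "u = u1 @ u2" "erase_tau u1 = s'" "erase_tau u2 = t"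
      using Cons.IH[OF s'(1)] by blast
    then show ?thesis
      using s'(2) by (intro exI[of _ "e # u1"] exI[of _ u2]) (cases e; auto)
  qed
qed simp

lemma weak_run_append: "weak_run G p (s @ t) q \<longleftrightarrow> (\<exists>m. weak_run G p s m \<and> weak_run G m t q)"
proof
  assume "weak_run G p (s @ t) q"
  then show "\<exists>m. weak_run G p s m \<and> weak_run G m t q"
    unfolding weak_run_def by (metis erase_tau_eq_appendD run_append)
next
  assume "\<exists>m. weak_run G p s m \<and> weak_run G m t q"
  then show "weak_run G p (s @ t) q"
    unfolding weak_run_def by (metis erase_tau_simps(4) run_append)
qed

lemma weak_run_refl [simp]: "weak_run G p [] p"
  unfolding weak_run_def by (rule exI[of _ "[]"]) simp

lemma weak_run_tau: "(p, None, q) \<in> trans G \<Longrightarrow> weak_run G p [] q"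
  unfolding weak_run_def by (rule exI[of _ "[None]"]) simp

lemma weak_run_event: "(p, Some a, q) \<in> trans G \<Longrightarrow> weak_run G p [a] q"
  unfolding weak_run_def by (rule exI[of _ "[Some a]"]) simp

lemma weak_run_trans:
  "weak_run G p s m \<Longrightarrow> weak_run G m t q \<Longrightarrow> weak_run G p (s @ t) q"
  by (auto simp: weak_run_append)

text \<open>Induction on the underlying run: leading unobservable moves are collected into the first
  segment, and once the event has been met the remaining run erases to the empty string.\<close>

lemma weak_run_singletonD:
  assumes "weak_run G p [a] q"
  shows "\<exists>x y. weak_run G p [] x \<and> (x, Some a, y) \<in> trans G \<and> weak_run G y [] q"
proof -
  have "run G p u q \<Longrightarrow> erase_tau u = [a] \<Longrightarrow> ?thesis" for u
  proof (induction u arbitrary: p)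
    case (Cons e u)
    then obtain r where r: "(p, e, r) \<in> trans G" "run G r u q" by auto
    show ?case
    proof (cases e)
      case None
      then obtain x y where "weak_run G r [] x" "(x, Some a, y) \<in> trans G" "weak_run G y [] q"
        using Cons.IH[OF r(2)] Cons.prems(2) by auto
      then show ?thesis
        using weak_run_trans[OF weak_run_tau, of p r G "[]" x] r(1) None by auto
    next
      case (Some b)
      then have "weak_run G r [] q" "b = a"
        using Cons.prems(2) r(2) by (auto simp: weak_run_def)
      then show ?thesis
        using r(1) Some by (intro exI[of _ p] exI[of _ r]) simp
    qed
  qed simp
  then show ?thesis
    using assms by (auto simp: weak_run_def)
qed

lemma weak_run_singleton_iff:
  "weak_run G p [a] q \<longleftrightarrow>
     (\<exists>x y. weak_run G p [] x \<and> (x, Some a, y) \<in> trans G \<and> weak_run G y [] q)"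
proof
  assume "\<exists>x y. weak_run G p [] x \<and> (x, Some a, y) \<in> trans G \<and> weak_run G y [] q"
  then obtain x y where "weak_run G p [] x" "weak_run G x [a] y" "weak_run G y [] q"
    using weak_run_event by fast
  then show "weak_run G p [a] q"
    using weak_run_trans[of G p "[]" x "[a]" y] weak_run_trans[of G p "[a]" y "[]" q] by simp
qed (rule weak_run_singletonD)

section \<open>Well-formedness, reversed automata and accessible parts\<close>

lemma run_states:
  "automaton G \<Longrightarrow> run G p t q \<Longrightarrow> p \<in> states G \<Longrightarrow> q \<in> states G"
  by (induction t arbitrary: p) (auto simp: automaton_def)

lemma weak_run_states:
  "automaton G \<Longrightarrow> weak_run G p s q \<Longrightarrow> p \<in> states G \<Longrightarrow> q \<in> states G"
  by (auto simp: weak_run_def dest: run_states)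

lemma run_reversed: "run (reversed G) p t q \<longleftrightarrow> run G q (rev t) p"
  by (induction t arbitrary: p) (auto simp: run_append reversed_def)

lemma weak_run_reversed: "weak_run (reversed G) p s q \<longleftrightarrow> weak_run G q (rev s) p"
  unfolding weak_run_def run_reversed by (metis erase_tau_simps(5) rev_rev_ident)

text \<open>The induction carries a run \<open>u\<close> from an initial state to the current state.
  It grows by one letter per step, so every transition used has both ends among the reachable
  states.\<close>

lemma run_accessible:
  assumes "run G p t q" "q0 \<in> init G" "run G q0 u p"
  shows "run (accessible G) p t q"
  using assms
proof (induction t arbitrary: p u)
  case (Cons e t)
  then obtain r where r: "(p, e, r) \<in> trans G" "run G r t q" by auto
  have "run G q0 (u @ [e]) r"
    using Cons.prems(3) r(1) by (auto simp: run_snoc)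
  moreover have "(p, e, r) \<in> trans (accessible G)"
    using r(1) Cons.prems(2,3) \<open>run G q0 (u @ [e]) r\<close>
    by (auto simp: accessible_def Let_def)
  ultimately show ?case
    using Cons.IH[OF r(2) Cons.prems(2)] by auto
qed simp

lemma leads_to_accessible: "leads_to G s x \<Longrightarrow> leads_to (accessible G) s x"
  using run_accessible[of G _ "map Some s" x _ "[]"]
  by (auto simp: leads_to_def) (auto simp: accessible_def Let_def)

lemma automaton_accessible:
  assumes "automaton G"
  shows "automaton (accessible G)"
proof -
  have "q \<in> {q. \<exists>q0 \<in> init G. \<exists>t. run G q0 t q}" if "q \<in> init G" for q
    using that by (auto intro!: bexI[of _ q] exI[of _ "[]"])
  then show ?thesis
    using assms by (fastforce simp: automaton_def accessible_def Let_def)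
qed

lemma automaton_reversed: "automaton G \<Longrightarrow> automaton (reversed G)"
  by (auto simp: automaton_def reversed_def)

lemma automaton_rename: "automaton G \<Longrightarrow> automaton (rename f G)"
  by (fastforce simp: automaton_def rename_def)

lemma automaton_sync2: "automaton A \<Longrightarrow> automaton B \<Longrightarrow> automaton (sync2 A B)"
  by (auto simp: automaton_def sync2_def)

section \<open>State estimates and the current-state estimator\<close>

definition estimate :: "('e, 'q) automaton \<Rightarrow> 'e list \<Rightarrow> 'q set" where
  "estimate G s = {y. \<exists>x \<in> init G. weak_run G x s y}"

lemma UR_eq: "UR G B = {y. \<exists>x \<in> B. weak_run G x [] y}"
  unfolding UR_def weak_run_def erase_tau_eq_Nil_iff by blast

lemma UR_subset_states: "automaton G \<Longrightarrow> B \<subseteq> states G \<Longrightarrow> UR G B \<subseteq> states G"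
  by (auto simp: UR_eq dest: weak_run_states)

lemma estimate_subset_states: "automaton G \<Longrightarrow> estimate G s \<subseteq> states G"
  by (auto simp: estimate_def automaton_def dest: weak_run_states[rotated])

text \<open>One step of the subset construction. Unobservable moves before \<open>a\<close> are
  absorbed because \<open>estimate G s\<close> is already closed under them; those after
  \<open>a\<close> are supplied by \<open>UR\<close>.\<close>

lemma estimate_snoc:
  "estimate G (s @ [a]) = \<Union> {UR G {y} | x y. x \<in> estimate G s \<and> (x, Some a, y) \<in> trans G}"
proof -
  have "weak_run G p (s @ [a]) q \<longleftrightarrow>
      (\<exists>x y. weak_run G p s x \<and> (x, Some a, y) \<in> trans G \<and> weak_run G y [] q)" for p q
    unfolding weak_run_append weak_run_singleton_iff
    using weak_run_trans[of G p s _ "[]"] by (metis append_Nil2 weak_run_refl)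
  then show ?thesis
    unfolding estimate_def UR_eq by auto
qed

lemma estimate_append_nonempty: "estimate G (s @ t) \<noteq> {} \<Longrightarrow> estimate G s \<noteq> {}"
  by (auto simp: estimate_def weak_run_append)

text \<open>\<open>estimate\<close> is the closed form of the state that \<open>det G\<close>
  reaches. Since \<open>det G\<close> has no transitions into the empty set, the estimate has to be
  nonempty; this passes to all prefixes of \<open>s\<close>, so no step on the way blocks.\<close>

lemma leads_to_det:
  assumes "automaton G" "s \<in> lists (alph G)" "estimate G s \<noteq> {}"
  shows "leads_to (det G) s (estimate G s)"
  unfolding det_def
proof (rule leads_to_accessible)
  let ?D = "\<lparr>alph = alph G, states = Pow (states G),
      trans = {(X, Some \<sigma>, Y) | X \<sigma> Y. X \<subseteq> states G \<and> \<sigma> \<in> alph G \<and>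
           Y = \<Union> {UR G {y} | x y. x \<in> X \<and> (x, Some \<sigma>, y) \<in> trans G} \<and> Y \<noteq> {}},
      init = {UR G (init G)}\<rparr>"
  show "leads_to ?D s (estimate G s)"
    using assms(2,3)
  proof (induction s rule: rev_induct)
    case Nil
    then show ?case
      by (simp add: leads_to_def UR_eq estimate_def)
  next
    case (snoc a s)
    have "leads_to ?D s (estimate G s)"
      using snoc estimate_append_nonempty[of G s "[a]"] by simp
    moreover have "(estimate G s, Some a, estimate G (s @ [a])) \<in> trans ?D"
      using snoc.prems estimate_subset_states[OF assms(1), of s] by (simp add: estimate_snoc)
    ultimately show ?case
      by (auto simp: leads_to_def run_snoc simp del: automaton.select_convs(3))
  qed
qed

lemma automaton_det:
  assumes "automaton G"
  shows "automaton (det G)"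
  unfolding det_def
proof (rule automaton_accessible)
  have "z \<in> states G" if "(x, e, y) \<in> trans G" "z \<in> UR G {y}" for x e y z
    using that assms UR_subset_states[of G "{y}"] by (auto simp: automaton_def)
  then show "automaton \<lparr>alph = alph G, states = Pow (states G),
      trans = {(X, Some \<sigma>, Y) | X \<sigma> Y. X \<subseteq> states G \<and> \<sigma> \<in> alph G \<and>
           Y = \<Union> {UR G {y} | x y. x \<in> X \<and> (x, Some \<sigma>, y) \<in> trans G} \<and> Y \<noteq> {}},
      init = {UR G (init G)}\<rparr>"
    using assms UR_subset_states[of G "init G"] by (auto simp: automaton_def)
qed

section \<open>Renaming, natural projection, and runs of compositions without unobservable
  moves\<close>

lemma run_rename: "run G p t q \<Longrightarrow> run (rename f G) p (map (map_option f) t) q"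
  by (induction t arbitrary: p) (auto simp: rename_def)

lemma leads_to_rename: "leads_to G s x \<Longrightarrow> leads_to (rename f G) (map f s) x"
  unfolding leads_to_def
  by (force dest: run_rename[of _ _ _ _ f] simp: rename_def comp_def)

lemma nat_proj_simps [simp]:
  "nat_proj A [] = []"
  "nat_proj A (a # s) = (if a \<in> A then a # nat_proj A s else nat_proj A s)"
  "nat_proj A (s @ t) = nat_proj A s @ nat_proj A t"
  "nat_proj A (rev s) = rev (nat_proj A s)"
  by (simp_all add: nat_proj_def rev_filter)

lemma nat_proj_id: "s \<in> lists A \<Longrightarrow> nat_proj A s = s"
  by (auto simp: nat_proj_def in_lists_conv_set)

lemma nat_proj_map:
  assumes "\<And>x. x \<in> set s \<Longrightarrow> f x \<in> A \<longleftrightarrow> x \<in> B"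
  shows "nat_proj A (map f s) = map f (nat_proj B s)"
  using assms by (induction s) auto

text \<open>Letter by letter, a component follows its projected run if the letter is in its alphabet
  and stays put otherwise, exactly when the projection drops the letter. Membership in the state
  sets is carried along because transitions of \<open>sync2\<close> demand it.\<close>

lemma run_sync2:
  assumes AB: "automaton A" "automaton B"
  shows "run A a (map Some (nat_proj (alph A) w)) a' \<Longrightarrow>
    run B b (map Some (nat_proj (alph B) w)) b' \<Longrightarrow>
    a \<in> states A \<Longrightarrow> b \<in> states B \<Longrightarrow> w \<in> lists (alph A \<union> alph B) \<Longrightarrow>
    run (sync2 A B) (a, b) (map Some w) (a', b')"
proof (induction w arbitrary: a b)
  case (Cons e w)
  obtain a1 where a1: "run A a1 (map Some (nat_proj (alph A) w)) a'"
      "if e \<in> alph A then (a, Some e, a1) \<in> trans A else a1 = a"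
    using Cons.prems(1) by (auto split: if_splits)
  obtain b1 where b1: "run B b1 (map Some (nat_proj (alph B) w)) b'"
      "if e \<in> alph B then (b, Some e, b1) \<in> trans B else b1 = b"
    using Cons.prems(2) by (auto split: if_splits)
  have st: "a1 \<in> states A" "b1 \<in> states B"
    using a1(2) b1(2) Cons.prems(3,4) AB by (auto simp: automaton_def split: if_splits)
  have "((a, b), Some e, (a1, b1)) \<in> trans (sync2 A B)"
    using a1(2) b1(2) st Cons.prems(3-5) by (auto simp: sync2_def)
  moreover have "run (sync2 A B) (a1, b1) (map Some w) (a', b')"
    using Cons.IH[OF a1(1) b1(1) st] Cons.prems(5) by simp
  ultimately show ?case by auto
qed simp

lemma leads_to_sync2:
  assumes "automaton A" "automaton B" "w \<in> lists (alph A \<union> alph B)"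
    and "leads_to A (nat_proj (alph A) w) a" "leads_to B (nat_proj (alph B) w) b"
  shows "leads_to (sync2 A B) w (a, b)"
proof -
  obtain p q where pq: "p \<in> init A" "run A p (map Some (nat_proj (alph A) w)) a"
      "q \<in> init B" "run B q (map Some (nat_proj (alph B) w)) b"
    using assms(4,5) unfolding leads_to_def by blast
  moreover have "p \<in> states A" "q \<in> states B"
    using pq assms(1,2) by (auto simp: automaton_def)
  ultimately have "run (sync2 A B) (p, q) (map Some w) (a, b)"
    using assms(1-3) by (intro run_sync2)
  then show ?thesis
    using pq unfolding leads_to_def by (intro bexI[of _ "(p, q)"]) (simp_all add: sync2_def)
qed

text \<open>The argument of \<open>run_sync2\<close> for a family. For the empty word,
  \<open>p\<close> and \<open>q\<close> are only known to agree on \<open>I\<close>; they are equal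
  as tuples because both are extensional.\<close>

lemma run_sync:
  assumes G: "\<And>i. i \<in> I \<Longrightarrow> automaton (G i)"
  shows "(\<And>i. i \<in> I \<Longrightarrow> run (G i) (p i) (map Some (nat_proj (alph (G i)) w)) (q i)) \<Longrightarrow>
    p \<in> (\<Pi>\<^sub>E i\<in>I. states (G i)) \<Longrightarrow> q \<in> extensional I \<Longrightarrow>
    w \<in> lists (\<Union>i\<in>I. alph (G i)) \<Longrightarrow> run (sync I G) p (map Some w) q"
proof (induction w arbitrary: p)
  case Nil
  then show ?case
    by (auto simp: PiE_iff intro: extensionalityI)
next
  case (Cons e w)
  have "\<exists>x. run (G i) x (map Some (nat_proj (alph (G i)) w)) (q i) \<and>
      (if e \<in> alph (G i) then (p i, Some e, x) \<in> trans (G i) else x = p i)" if "i \<in> I" for i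
    using Cons.prems(1)[OF that] by (auto split: if_splits)
  then obtain r0 where r0: "\<And>i. i \<in> I \<Longrightarrow>
      run (G i) (r0 i) (map Some (nat_proj (alph (G i)) w)) (q i) \<and>
      (if e \<in> alph (G i) then (p i, Some e, r0 i) \<in> trans (G i) else r0 i = p i)"
    by metis
  \<comment> \<open>The successors are chosen separately in each component; the restriction turns
    them into an extensional tuple, hence a state of the composition.\<close>
  define r where "r = restrict r0 I"
  have r: "run (G i) (r i) (map Some (nat_proj (alph (G i)) w)) (q i)"
      "if e \<in> alph (G i) then (p i, Some e, r i) \<in> trans (G i) else r i = p i" if "i \<in> I" for i
    using r0[OF that] that by (auto simp: r_def)
  have "r i \<in> states (G i)" if "i \<in> I" for i
    using r(2)[OF that] G[OF that] Cons.prems(2) that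
    by (auto simp: automaton_def split: if_splits)
  then have st: "r \<in> (\<Pi>\<^sub>E i\<in>I. states (G i))"
    by (simp add: r_def)
  have "(p, Some e, r) \<in> trans (sync I G)"
    using r(2) st Cons.prems(2,4) by (auto simp: sync_def)
  moreover have "run (sync I G) r (map Some w) q"
    using Cons.IH[OF r(1) st Cons.prems(3)] Cons.prems(4) by simp
  ultimately show ?case by auto
qed

lemma leads_to_sync:
  assumes G: "\<And>i. i \<in> I \<Longrightarrow> automaton (G i)"
    and q: "\<And>i. i \<in> I \<Longrightarrow> leads_to (G i) (nat_proj (alph (G i)) w) (q i)"
    and "q \<in> extensional I" "w \<in> lists (\<Union>i\<in>I. alph (G i))"
  shows "leads_to (sync I G) w q"
proof -
  obtain p0 where p0: "\<And>i. i \<in> I \<Longrightarrow>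
      p0 i \<in> init (G i) \<and> run (G i) (p0 i) (map Some (nat_proj (alph (G i)) w)) (q i)"
    using q unfolding leads_to_def by metis
  define p where "p = restrict p0 I"
  have init: "p \<in> (\<Pi>\<^sub>E i\<in>I. init (G i))"
    using p0 by (auto simp: p_def)
  moreover have "p \<in> (\<Pi>\<^sub>E i\<in>I. states (G i))"
    using p0 G by (auto simp: p_def automaton_def)
  moreover have "run (G i) (p i) (map Some (nat_proj (alph (G i)) w)) (q i)" if "i \<in> I" for i
    using p0[OF that] that by (simp add: p_def)
  ultimately have "run (sync I G) p (map Some w) q"
    using assms by (intro run_sync)
  then show ?thesis
    using init unfolding leads_to_def by (intro bexI[of _ p]) (simp_all add: sync_def)
qed

section \<open>Weak runs of a composition and of its components\<close>

lemma weak_run_sync_component: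
  assumes "weak_run (sync I G) p s q" "i \<in> I"
  shows "weak_run (G i) (p i) (nat_proj (alph (G i)) s) (q i)"
proof -
  have "run (sync I G) p t q \<Longrightarrow>
      weak_run (G i) (p i) (nat_proj (alph (G i)) (erase_tau t)) (q i)" for t
  proof (induction t arbitrary: p)
    case (Cons e t)
    then obtain r where r: "(p, e, r) \<in> trans (sync I G)"
        and IH: "weak_run (G i) (r i) (nat_proj (alph (G i)) (erase_tau t)) (q i)"
      by auto
    \<comment> \<open>A single transition of the composition is seen by component \<open>i\<close>
      as an unobservable move, an event of its own, or idling; idling matches an empty
      projection.\<close>
    have "weak_run (G i) (p i) (nat_proj (alph (G i)) (erase_tau [e])) (r i)"
    proof (cases e)
      case None
      then obtain j where "j \<in> I" "(p j, None, r j) \<in> trans (G j)" "\<forall>k \<in> I - {j}. r k = p k"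
        using r by (auto simp: sync_def)
      then show ?thesis
        using None \<open>i \<in> I\<close> weak_run_tau by (cases "i = j") auto
    next
      case (Some a)
      then have "if a \<in> alph (G i) then (p i, Some a, r i) \<in> trans (G i) else r i = p i"
        using r \<open>i \<in> I\<close> by (auto simp: sync_def)
      then show ?thesis
        using Some weak_run_event by (auto split: if_splits)
    qed
    then show ?case
      using weak_run_trans[OF _ IH, of "p i" "nat_proj (alph (G i)) (erase_tau [e])"]
      by (cases e) (auto split: if_splits)
  qed simp
  then show ?thesis
    using assms by (auto simp: weak_run_def)
qed

text \<open>Unobservable events are never shared, so the moves of component \<open>i\<close> lift
  one by one while the other coordinates keep their values.\<close>

lemma weak_run_sync_tau_update:
  assumes "automaton (G i)" "i \<in> I" "p \<in> (\<Pi>\<^sub>E i\<in>I. states (G i))" "weak_run (G i) (p i) [] x"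
  shows "weak_run (sync I G) p [] (p(i := x))"
proof -
  have "run (G i) (p i) t x \<Longrightarrow> t \<in> lists {None} \<Longrightarrow> p \<in> (\<Pi>\<^sub>E i\<in>I. states (G i)) \<Longrightarrow>
      weak_run (sync I G) p [] (p(i := x))" for t
  proof (induction t arbitrary: p)
    case (Cons e t)
    then obtain y where y: "(p i, None, y) \<in> trans (G i)" "run (G i) y t x"
      by auto
    let ?p = "p(i := y)"
    have st: "?p \<in> (\<Pi>\<^sub>E i\<in>I. states (G i))"
      using y(1) assms(1,2) Cons.prems(3) by (auto simp: automaton_def PiE_iff extensional_def)
    have "(p, None, ?p) \<in> trans (sync I G)"
      using y(1) assms(2) Cons.prems(3) st by (auto simp: sync_def)
    moreover have "weak_run (sync I G) ?p [] (?p(i := x))"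
      using y(2) st Cons.prems(2) by (intro Cons.IH) auto
    ultimately have "weak_run (sync I G) p ([] @ []) (?p(i := x))"
      by (intro weak_run_trans[of _ p "[]" ?p]) (rule weak_run_tau)
    then show ?case
      by (simp only: append_Nil fun_upd_upd)
  qed (auto simp: fun_upd_idem)
  then show ?thesis
    using assms(3,4) by (auto simp: weak_run_def erase_tau_eq_Nil_iff)
qed

text \<open>The components are moved to their targets one after another. In
  \<open>override_on p q J\<close> those in \<open>J\<close> have arrived and the others have not
  started; finiteness of \<open>I\<close> lets \<open>J\<close> grow to all of
  \<open>I\<close>.\<close>

lemma weak_run_sync_tau:
  assumes "finite I" and G: "\<And>i. i \<in> I \<Longrightarrow> automaton (G i)"
    and p: "p \<in> (\<Pi>\<^sub>E i\<in>I. states (G i))" and q: "q \<in> extensional I"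
    and tau: "\<And>i. i \<in> I \<Longrightarrow> weak_run (G i) (p i) [] (q i)"
  shows "weak_run (sync I G) p [] q"
proof -
  have "weak_run (sync I G) p [] (override_on p q J)" if "J \<subseteq> I" for J
    using finite_subset[OF that assms(1)] that
  proof (induction J rule: finite_induct)
    case (insert i J)
    let ?r = "override_on p q J"
    have "q j \<in> states (G j)" if "j \<in> I" for j
      using weak_run_states[OF G[OF that] tau[OF that]] p that by auto
    then have st: "?r \<in> (\<Pi>\<^sub>E i\<in>I. states (G i))"
      using p q insert.prems by (auto simp: override_on_def PiE_iff extensional_def)
    have "weak_run (sync I G) ?r [] (?r(i := q i))"
      using G insert.prems insert.hyps tau[of i] st
      by (intro weak_run_sync_tau_update) auto
    then have "weak_run (sync I G) p ([] @ []) (?r(i := q i))"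
      using insert.IH insert.prems by (intro weak_run_trans[of _ p "[]" ?r]) auto
    moreover have "override_on p q (insert i J) = ?r(i := q i)"
      by (rule override_on_insert)
    ultimately show ?case
      by (simp only: append_Nil)
  qed simp
  moreover have "override_on p q I = q"
    using p q by (auto simp: override_on_def PiE_iff extensional_def)
  ultimately show ?thesis
    by force
qed

text \<open>Converse of \<open>weak_run_sync_component\<close>. Before each event all components
  first finish their own unobservable moves, then the event is executed jointly, so the component
  runs need to agree only on the observable string.\<close>

lemma weak_run_sync:
  assumes I: "finite I" and G: "\<And>i. i \<in> I \<Longrightarrow> automaton (G i)"
  shows "(\<And>i. i \<in> I \<Longrightarrow> weak_run (G i) (p i) (nat_proj (alph (G i)) s) (q i)) \<Longrightarrow>
    p \<in> (\<Pi>\<^sub>E i\<in>I. states (G i)) \<Longrightarrow> q \<in> extensional I \<Longrightarrow>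
    s \<in> lists (\<Union>i\<in>I. alph (G i)) \<Longrightarrow> weak_run (sync I G) p s q"
proof (induction s arbitrary: p)
  case Nil
  then show ?case
    using weak_run_sync_tau[OF I G] by simp
next
  case (Cons e s)
  \<comment> \<open>Component \<open>i\<close> executes \<open>e\<close> from \<open>x\<close> to
    \<open>y\<close>, or idles with \<open>x\<close> and \<open>y\<close> both equal to
    \<open>p i\<close>. Unobservable moves following \<open>e\<close> are left to the run that
    starts in \<open>y\<close>.\<close>
  have "\<exists>x y. weak_run (G i) (p i) [] x \<and>
      (if e \<in> alph (G i) then (x, Some e, y) \<in> trans (G i) else y = x) \<and>
      weak_run (G i) y (nat_proj (alph (G i)) s) (q i)" if "i \<in> I" for i
  proof (cases "e \<in> alph (G i)")
    case True
    then obtain m where m: "weak_run (G i) (p i) [e] m"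
        "weak_run (G i) m (nat_proj (alph (G i)) s) (q i)"
      using Cons.prems(1)[OF \<open>i \<in> I\<close>]
        weak_run_append[of "G i" "p i" "[e]" "nat_proj (alph (G i)) s" "q i"] by auto
    obtain x y where "weak_run (G i) (p i) [] x" "(x, Some e, y) \<in> trans (G i)"
        "weak_run (G i) y [] m"
      using weak_run_singletonD[OF m(1)] by blast
    then show ?thesis
      using True weak_run_trans[OF _ m(2), of y "[]"] by auto
  next
    case False
    then show ?thesis
      using Cons.prems(1)[OF \<open>i \<in> I\<close>] by (intro exI[of _ "p i"]) auto
  qed
  then obtain x0 y0 where xy0: "\<And>i. i \<in> I \<Longrightarrow> weak_run (G i) (p i) [] (x0 i) \<and>
      (if e \<in> alph (G i) then (x0 i, Some e, y0 i) \<in> trans (G i) else y0 i = x0 i) \<and>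
      weak_run (G i) (y0 i) (nat_proj (alph (G i)) s) (q i)"
    by metis
  define x y where "x = restrict x0 I" and "y = restrict y0 I"
  have xy: "weak_run (G i) (p i) [] (x i)"
      "if e \<in> alph (G i) then (x i, Some e, y i) \<in> trans (G i) else y i = x i"
      "weak_run (G i) (y i) (nat_proj (alph (G i)) s) (q i)" if "i \<in> I" for i
    using xy0[OF that] that by (auto simp: x_def y_def)
  have xst: "x i \<in> states (G i)" if "i \<in> I" for i
    using weak_run_states[OF G[OF that] xy(1)[OF that]] Cons.prems(2) that by auto
  then have "y i \<in> states (G i)" if "i \<in> I" for i
    using xy(2)[OF that] G[OF that] that by (auto simp: automaton_def split: if_splits)
  then have st: "x \<in> (\<Pi>\<^sub>E i\<in>I. states (G i))" "y \<in> (\<Pi>\<^sub>E i\<in>I. states (G i))"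
    using xst by (auto simp: x_def y_def)
  have "weak_run (sync I G) p [] x"
    using weak_run_sync_tau[OF I G] Cons.prems(2) xy(1) by (simp add: x_def)
  moreover have "(x, Some e, y) \<in> trans (sync I G)"
    using xy(2) st Cons.prems(4) by (auto simp: sync_def)
  ultimately have "weak_run (sync I G) p [e] y"
    unfolding weak_run_singleton_iff by (intro exI[of _ x] exI[of _ y]) simp
  moreover have "weak_run (sync I G) y s q"
    using Cons.IH[OF xy(3) st(2) Cons.prems(3)] Cons.prems(4) by simp
  ultimately show ?case
    using weak_run_trans by fastforce
qed

section \<open>Runs of two-way observers\<close>

lemma alph_det [simp]: "alph (det G) = alph G"
  by (simp add: det_def accessible_def Let_def)

lemma alph_two_way_observer:
  "alph (two_way_observer G) = Delta ` alph G \<union> Delta_R ` alph G"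
  by (simp add: two_way_observer_def sync2_def rename_def) (simp add: reversed_def)

lemma automaton_two_way_observer: "automaton G \<Longrightarrow> automaton (two_way_observer G)"
  unfolding two_way_observer_def
  by (intro automaton_sync2 automaton_rename automaton_det automaton_reversed)

text \<open>\<open>Delta\<close> and \<open>Delta_R\<close> are injective with disjoint ranges. Two
  separate sets \<open>A\<close> and \<open>B\<close> also cover projections onto one kind of
  renamed event, by taking the other set empty.\<close>

lemma nat_proj_Delta:
  "nat_proj (Delta ` A \<union> Delta_R ` B) (map Delta s) = map Delta (nat_proj A s)"
  "nat_proj (Delta ` A \<union> Delta_R ` B) (map Delta_R s) = map Delta_R (nat_proj B s)"
  by (auto intro!: nat_proj_map simp: Delta_def Delta_R_def)

text \<open>The two estimators share no renamed event, so each projects the word to its own half and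
  runs independently of the other.\<close>

lemma leads_to_two_way_observer:
  assumes G: "automaton G" and s: "s \<in> lists (alph G)" and t: "t \<in> lists (alph G)"
    and "estimate G s \<noteq> {}" "estimate (reversed G) t \<noteq> {}"
  shows "leads_to (two_way_observer G) (map Delta s @ map Delta_R t)
    (estimate G s, estimate (reversed G) t)"
  unfolding two_way_observer_def
proof (rule leads_to_sync2)
  let ?A = "rename Delta (det G)" and ?B = "rename Delta_R (det (reversed G))"
  let ?w = "map Delta s @ map Delta_R t"
  have alph: "alph ?A = Delta ` alph G" "alph ?B = Delta_R ` alph G"
    by (simp_all add: rename_def) (simp add: reversed_def)
  show "automaton ?A" "automaton ?B"
    using G by (auto intro: automaton_rename automaton_det automaton_reversed)
  show "?w \<in> lists (alph ?A \<union> alph ?B)"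
    using s t by (auto simp: alph)
  have "nat_proj (alph ?A) ?w = map Delta s"
    using nat_proj_Delta[of "alph G" "{}"] nat_proj_id[OF s]
    by (simp add: alph nat_proj_def)
  then show "leads_to ?A (nat_proj (alph ?A) ?w) (estimate G s)"
    using leads_to_rename[OF leads_to_det[OF G s assms(4)]] by simp
  have "nat_proj (alph ?B) ?w = map Delta_R t"
    using nat_proj_Delta[of "{}" "alph G"] nat_proj_id[OF t]
    by (simp add: alph nat_proj_def)
  moreover have "t \<in> lists (alph (reversed G))"
    using t by (simp add: reversed_def)
  ultimately show "leads_to ?B (nat_proj (alph ?B) ?w) (estimate (reversed G) t)"
    using leads_to_rename[OF leads_to_det[OF automaton_reversed[OF G] _ assms(5)]] by simp
qed

section \<open>Opacity of the composed system from the condition on \<open>H\<close>\<close>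

lemma leads_to_imp_lang:
  assumes "leads_to G s x" "s \<in> lists (alph G)"
  shows "s \<in> lang G"
proof -
  obtain q where "q \<in> init G" "run G q (map Some s) x"
    using assms(1) by (auto simp: leads_to_def)
  then show ?thesis
    using assms(2) erase_tau_simps(6)[of s] unfolding lang_def lang_from_def weak_run_def by blast
qed

text \<open>All states are initial in \<open>reversed G\<close>, so an estimate after
  \<open>rev t\<close> collects the states from which \<open>t\<close> can be executed;
  \<open>z\<close> is the initial state of the backward run.\<close>

lemma mem_estimate_reversed_iff:
  "y \<in> estimate (reversed G) (rev t) \<longleftrightarrow> (\<exists>z \<in> states G. weak_run G y t z)"
  by (simp add: estimate_def weak_run_reversed) (simp add: reversed_def)

theorem theorem8:
  fixes K n :: nat
    and G :: "nat \<Rightarrow> ('e, 'q) automaton"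
    and QS :: "nat \<Rightarrow> 'q set"
    and H :: "('e option \<times> 'e option, nat \<Rightarrow> 'q set \<times> 'q set) automaton"
  assumes G: "\<And>i. i \<in> {1..n} \<Longrightarrow> automaton (G i)"
    and QS: "\<And>i. i \<in> {1..n} \<Longrightarrow> QS i \<subseteq> states (G i)"
    and H: "H = sync {1..n} (\<lambda>i. two_way_observer (G i))"
    and cond: "\<And>s x. s \<in> lang H \<Longrightarrow> leads_to H s x \<Longrightarrow>
      (\<exists>i \<in> {1..n}. fst (x i) \<inter> snd (x i) \<subseteq> QS i \<and> fst (x i) \<inter> snd (x i) \<noteq> {}) \<Longrightarrow>
      length (nat_proj (Delta_R ` (\<Union>i \<in> {1..n}. alph (G i))) s) > K"
  shows "k_step_opaque K (sync {1..n} G)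
    (states (sync {1..n} G) - (\<Pi>\<^sub>E i\<in>{1..n}. states (G i) - QS i))"
  unfolding k_step_opaque_def
proof (intro ballI impI, elim conjE)
  let ?I = "{1..n}"
  let ?\<Sigma> = "\<Union>i\<in>?I. alph (G i)"
  let ?C = "sync ?I G"
  fix q0 s t
  assume q0: "q0 \<in> init ?C" and "s \<in> lists (alph ?C)" "t \<in> lists (alph ?C)"
    and "s @ t \<in> lang_from ?C q0" and len: "length t \<le> K"
  then have s: "s \<in> lists ?\<Sigma>" and t: "t \<in> lists ?\<Sigma>"
    by (simp_all add: sync_def)
  obtain m z where m: "weak_run ?C q0 s m" and z: "weak_run ?C m t z"
    using \<open>s @ t \<in> lang_from ?C q0\<close> by (auto simp: lang_from_def weak_run_append)
  define si ti where "si i = nat_proj (alph (G i)) s" and "ti i = nat_proj (alph (G i)) t" for i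
  define X XR where "X i = estimate (G i) (si i)"
    and "XR i = estimate (reversed (G i)) (rev (ti i))" for i
  \<comment> \<open>This membership serves twice: it makes both estimates nonempty, so that the
    observers do not block, and it later excludes the case of an empty intersection in
    \<open>cond\<close>.\<close>
  have m_in: "m i \<in> X i \<inter> XR i" if i: "i \<in> ?I" for i
  proof -
    have q0i: "q0 i \<in> init (G i)"
      using q0 i by (auto simp: sync_def)
    have mi: "weak_run (G i) (q0 i) (si i) (m i)" and zi: "weak_run (G i) (m i) (ti i) (z i)"
      using weak_run_sync_component[OF m i] weak_run_sync_component[OF z i]
      by (auto simp: si_def ti_def)
    have "z i \<in> states (G i)"
      using q0i G[OF i] weak_run_states[OF G[OF i] weak_run_trans[OF mi zi]]
      by (auto simp: automaton_def)
    then show ?thesis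
      using q0i mi zi unfolding X_def XR_def Int_iff mem_estimate_reversed_iff
      by (auto simp: estimate_def)
  qed
  \<comment> \<open>Projecting \<open>w\<close> to the \<open>Delta_R\<close> events leaves the
    image of \<open>rev t\<close>, whose length is that of \<open>t\<close>. Projecting it to the
    alphabet of the observer of \<open>G i\<close> leaves the word built from \<open>si i\<close>
    and \<open>ti i\<close>.\<close>
  define w where "w = map Delta s @ map Delta_R (rev t)"
  define x where "x = (\<lambda>i\<in>?I. (X i, XR i))"
  have w: "w \<in> lists (\<Union>i\<in>?I. alph (two_way_observer (G i)))"
    using s t by (fastforce simp: w_def alph_two_way_observer in_lists_conv_set)
  have x: "leads_to H w x"
    unfolding H
  proof (rule leads_to_sync)
    fix i assume i: "i \<in> ?I"
    have "nat_proj (alph (two_way_observer (G i))) w = map Delta (si i) @ map Delta_R (rev (ti i))"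
      by (simp only: w_def alph_two_way_observer nat_proj_simps nat_proj_Delta si_def ti_def)
    moreover have "leads_to (two_way_observer (G i)) (map Delta (si i) @ map Delta_R (rev (ti i)))
        (X i, XR i)"
      unfolding X_def XR_def using m_in[OF i]
      by (intro leads_to_two_way_observer G i)
        (auto simp: X_def XR_def si_def ti_def nat_proj_def)
    ultimately show "leads_to (two_way_observer (G i))
        (nat_proj (alph (two_way_observer (G i))) w) (x i)"
      using i by (simp add: x_def)
  qed (use w G automaton_two_way_observer in \<open>auto simp: x_def\<close>)
  moreover have "w \<in> lang H"
    using leads_to_imp_lang[OF x] w by (simp add: H sync_def)
  moreover have "length (nat_proj (Delta_R ` ?\<Sigma>) w) = length t"
    using nat_proj_Delta[of "{}" ?\<Sigma>] nat_proj_id[of "rev t" ?\<Sigma>] t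
    by (simp add: w_def nat_proj_def in_lists_conv_set)
  \<comment> \<open>Contrapositive of \<open>cond\<close>: the projection of \<open>w\<close> has
    length at most \<open>K\<close>.\<close>
  ultimately have "\<not> (\<exists>i \<in> ?I. fst (x i) \<inter> snd (x i) \<subseteq> QS i \<and> fst (x i) \<inter> snd (x i) \<noteq> {})"
    using cond[of w x] len by linarith
  then have "\<exists>y. y \<in> X i \<inter> XR i - QS i" if "i \<in> ?I" for i
    using m_in[OF that] that by (auto simp: x_def)
  \<comment> \<open>Membership of \<open>y\<close> in \<open>X i\<close> supplies an initial state
    \<open>p\<close> leading to it under \<open>si i\<close>; membership in \<open>XR i\<close>
    supplies a state \<open>z\<close> that it reaches under \<open>ti i\<close>.\<close>
  then have "\<exists>p y z. y \<notin> QS i \<and> p \<in> init (G i) \<and> weak_run (G i) p (si i) y \<and>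
      z \<in> states (G i) \<and> weak_run (G i) y (ti i) z" if "i \<in> ?I" for i
    using that unfolding X_def XR_def Diff_iff Int_iff mem_estimate_reversed_iff
    by (fastforce simp: estimate_def)
  then obtain p y z where pyz: "\<And>i. i \<in> ?I \<Longrightarrow> y i \<notin> QS i \<and> p i \<in> init (G i) \<and>
      weak_run (G i) (p i) (si i) (y i) \<and> z i \<in> states (G i) \<and> weak_run (G i) (y i) (ti i) (z i)"
    by metis
  let ?p = "restrict p ?I" and ?y = "restrict y ?I" and ?z = "restrict z ?I"
  have p_states: "p i \<in> states (G i)" if "i \<in> ?I" for i
    using pyz[OF that] G[OF that] by (auto simp: automaton_def)
  have y_states: "y i \<in> states (G i)" if "i \<in> ?I" for i
    using pyz[OF that] weak_run_states[OF G[OF that]] p_states[OF that] by blast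
  have "?p \<in> init ?C"
    using pyz by (auto simp: sync_def)
  \<comment> \<open>Removing the secret states leaves the product of the nonsecret sets, so
    \<open>?y\<close> must be nonsecret in every component at once.\<close>
  moreover have "?y \<in> states ?C -
      (states ?C - (\<Pi>\<^sub>E i\<in>?I. states (G i) - QS i))"
    using pyz y_states by (auto simp: sync_def)
  moreover have "weak_run ?C ?p s ?y"
    using pyz p_states s G by (intro weak_run_sync) (auto simp: si_def)
  moreover have "weak_run ?C ?y t ?z"
    using pyz y_states t G by (intro weak_run_sync) (auto simp: ti_def)
  ultimately show "\<exists>q0' \<in> init ?C. \<exists>y \<in> states ?C -
      (states ?C - (\<Pi>\<^sub>E i\<in>?I. states (G i) - QS i)).
      weak_run ?C q0' s y \<and> (\<exists>z. weak_run ?C y t z)"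
    by blast
qed

end
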